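(* Let $n_\sigma\in\{2,3,\dots\}$, $\mathfrak{C}\in(1,\infty)$, $\alpha,\beta\in(0,1)$, $\varepsilon>0$, $\sigma_{\max}>0$, and put $\tilde\alpha=1-\sqrt{1-\alpha}$ and $\tilde\kappa_{\max}=\tilde\kappa_{\max}(\tilde\alpha,n_\sigma,\mathfrak{C})$. Then the probabilistic cost $N_{\mathrm{tot}}(\varepsilon,\alpha,\beta,\tilde\kappa_{\max},\sigma_{\max})$ of the two-stage Monte Carlo algorithm (defined in the context) is bounded above by $$N_{\mathrm{tot}}(\varepsilon,\alpha,\beta,\tilde\kappa_{\max},\sigma_{\max})\le N_{\mathrm{up}}(\varepsilon,\alpha,\beta,\tilde\kappa_{\max},\sigma_{\max}):=n_\sigma+N_\mu\bigl(\varepsilon,\ \sigma_{\max}\,v(\tilde\alpha,\beta,\mathfrak{C}),\ \tilde\alpha,\ \tilde\kappa_{\max}^{3/4}\bigr),$$ where $v(\tilde\alpha,\beta,\mathfrak{C})>0$ is given by $$v^2(\tilde\alpha,\beta,\mathfrak{C}):=\mathfrak{C}^2+(\mathfrak{C}^2-1)\sqrt{\frac{\tilde\alpha(1-\beta)}{(1-\tilde\alpha)\beta}} .$$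
   Context: **Notation.** $\Phi$ is the standard normal cumulative distribution function and $\mathbb{N}=\{1,2,\dots\}$. For $\alpha\in(0,1)$, $n_\sigma\in\{2,3,\dots\}$, $\mathfrak{C}>1$ define $$\tilde\kappa_{\max}(\alpha,n_\sigma,\mathfrak{C}):=\frac{n_\sigma-3}{n_\sigma-1}+\left(\frac{\alpha n_\sigma}{1-\alpha}\right)\left(1-\frac1{\mathfrak{C}^2}\right)^2 .$$ For $n\in\mathbb{N}$, $x\in\mathbb{R}$, $M>0$ define $$\Delta_n(x,M):=\frac1{\sqrt n}\min\left(A_1(M+A_2),\ \frac{A_3M}{1+|x|^3}\right),\qquad A_1=0.3328,\ A_2=0.429,\ A_3=18.1139.$$ For $\varepsilon>0$, $\sigma>0$, $\alpha\in(0,1)$, $M>0$ define $$N_{\mathrm{Cheb}}(\varepsilon,\sigma,\alpha)=\left\lceil\frac{\sigma^2}{\alpha\varepsilon^2}\right\rceil,$$ $$N_{\mathrm{BE}}(\varepsilon,\sigma,\alpha,M)=\min\left\{n\in\mathbb{N}:\Phi\left(-\sqrt n\,\varepsilon/\sigma\right)+\Delta_n\left(\sqrt n\,\varepsilon/\sigma,M\right)\le\frac\alpha2\right\},$$ $$N_\mu(\varepsilon,\sigma,\alpha,M)=\max\bigl(1,\min\bigl(N_{\mathrm{Cheb}}(\varepsilon,\sigma,\alpha),N_{\mathrm{BE}}(\varepsilon,\sigma,\alpha,M)\bigr)\bigr),$$ and for $\sigma=0$ set $N_\mu(\varepsilon,0,\alpha,M)=1$. **The two-stage algorithm and its number of samples.**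 Inputs: $n_\sigma$, $\mathfrak{C}^2$, $\alpha$, $\varepsilon$, and IID samples $Y_1,Y_2,\dots$ with common distribution function $F$. Stage 1 computes the sample variance $s_{n_\sigma}^2=\frac1{n_\sigma-1}\sum_{i=1}^{n_\sigma}\bigl(Y_i-\frac1{n_\sigma}\sum_{j=1}^{n_\sigma}Y_j\bigr)^2$ and $\hat\sigma^2=\mathfrak{C}^2s_{n_\sigma}^2$, with $\hat\sigma\ge0$. Stage 2 uses $n_\mu=N_\mu(\varepsilon,\hat\sigma,\tilde\alpha,\tilde\kappa_{\max}^{3/4})$ further samples, with $\tilde\alpha=1-\sqrt{1-\alpha}$ and $\tilde\kappa_{\max}=\tilde\kappa_{\max}(\tilde\alpha,n_\sigma,\mathfrak{C})$, and returns $\frac1{n_\mu}\sum_{i=n_\sigma+1}^{n_\sigma+n_\mu}Y_i$. The total number of samples is the random variable $N_{\mathrm{tot}}(\varepsilon,\alpha,\tilde\kappa_{\max},F)=n_\sigma+N_\mu(\varepsilon,\hat\sigma,\tilde\alpha,\tilde\kappa_{\max}^{3/4})$. **Probabilistic cost.** For a distribution function $F$ on $\mathbb{R}$ with mean $\mu$ and variance $\sigma^2>0$, the modified kurtosis is $\tilde\kappa=\mathbb{E}[(Y-\mu)^4]/\sigma^4$, where $Y\sim F$. The probabilistic cost with uncertainty $\beta$ is $$N_{\mathrm{tot}}(\varepsilon,\alpha,\beta,\tilde\kappa_{\max},\sigma_{\max}):=\sup_{F}\ \min\bigl\{N\in\mathbb{N}:\Pr[N_{\mathrm{tot}}(\varepsilon,\alpha,\tilde\kappa_{\max},F)\le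 N]\ge1-\beta\bigr\},$$ where the supremum is over all distribution functions $F$ whose standard deviation $\sigma$ and modified kurtosis $\tilde\kappa$ satisfy $0<\sigma\le\sigma_{\max}$ and $\tilde\kappa\le\tilde\kappa_{\max}$. *)

theory Defs
  imports "HOL-Probability.Probability" "HOL-Library.Extended_Nat"
begin

definition kappa_max :: "real \<Rightarrow> nat \<Rightarrow> real \<Rightarrow> real" where
  "kappa_max \<alpha> n\<^sub>\<sigma> C =
     (real n\<^sub>\<sigma> - 3) / (real n\<^sub>\<sigma> - 1)
     + (\<alpha> * real n\<^sub>\<sigma> / (1 - \<alpha>)) * (1 - 1 / C\<^sup>2)\<^sup>2"

definition Phi :: "real \<Rightarrow> real" where
  "Phi = cdf std_normal_distribution"

(* Minimum of a uniform and a nonuniform Berry-Esseen bound; M stands for E|Y - mu|^3 / sigma^3,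
   which Jensen's inequality bounds by kurtosis^(3/4). *)
definition Delta :: "nat \<Rightarrow> real \<Rightarrow> real \<Rightarrow> real" where
  "Delta n x M =
     1 / sqrt (real n) * min (0.3328 * (M + 0.429)) (18.1139 * M / (1 + \<bar>x\<bar> ^ 3))"

definition N_Cheb :: "real \<Rightarrow> real \<Rightarrow> real \<Rightarrow> nat" where
  "N_Cheb \<epsilon> \<sigma> \<alpha> = nat \<lceil>\<sigma>\<^sup>2 / (\<alpha> * \<epsilon>\<^sup>2)\<rceil>"

definition N_BE :: "real \<Rightarrow> real \<Rightarrow> real \<Rightarrow> real \<Rightarrow> nat" where
  "N_BE \<epsilon> \<sigma> \<alpha> M =
     (LEAST n. 1 \<le> n \<and>
        Phi (- sqrt (real n) * \<epsilon> / \<sigma>) + Delta n (sqrt (real n) * \<epsilon> / \<sigma>) M \<le> \<alpha> / 2)"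

definition N_mu :: "real \<Rightarrow> real \<Rightarrow> real \<Rightarrow> real \<Rightarrow> nat" where
  "N_mu \<epsilon> \<sigma> \<alpha> M =
     (if \<sigma> = 0 then 1 else max 1 (min (N_Cheb \<epsilon> \<sigma> \<alpha>) (N_BE \<epsilon> \<sigma> \<alpha> M)))"

(* A sample sequence Y_1, Y_2, ... is a function Y :: nat => real; the value Y 0 is never used. *)
definition sample_variance :: "nat \<Rightarrow> (nat \<Rightarrow> real) \<Rightarrow> real" where
  "sample_variance n Y =
     (\<Sum>i=1..n. (Y i - (\<Sum>j=1..n. Y j) / real n)\<^sup>2) / (real n - 1)"

definition sigma_hat :: "nat \<Rightarrow> real \<Rightarrow> (nat \<Rightarrow> real) \<Rightarrow> real" where
  "sigma_hat n\<^sub>\<sigma> C Y = sqrt (C\<^sup>2 * sample_variance n\<^sub>\<sigma> Y)"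

definition alpha_tilde :: "real \<Rightarrow> real" where
  "alpha_tilde \<alpha> = 1 - sqrt (1 - \<alpha>)"

definition N_tot :: "nat \<Rightarrow> real \<Rightarrow> real \<Rightarrow> real \<Rightarrow> real \<Rightarrow> (nat \<Rightarrow> real) \<Rightarrow> nat" where
  "N_tot n\<^sub>\<sigma> C \<epsilon> \<alpha> \<kappa> Y =
     n\<^sub>\<sigma> + N_mu \<epsilon> (sigma_hat n\<^sub>\<sigma> C Y) (alpha_tilde \<alpha>) (\<kappa> powr (3/4))"

definition distribution_function :: "(real \<Rightarrow> real) \<Rightarrow> bool" where
  "distribution_function F \<longleftrightarrow>
     mono F \<and> (\<forall>a. continuous (at_right a) F) \<and> (F \<longlongrightarrow> 0) at_bot \<and> (F \<longlongrightarrow> 1) at_top"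

definition df_mean :: "(real \<Rightarrow> real) \<Rightarrow> real" where
  "df_mean F = (\<integral>y. y \<partial>interval_measure F)"

definition df_sd :: "(real \<Rightarrow> real) \<Rightarrow> real" where
  "df_sd F = sqrt (\<integral>y. (y - df_mean F)\<^sup>2 \<partial>interval_measure F)"

definition modified_kurtosis :: "(real \<Rightarrow> real) \<Rightarrow> real" where
  "modified_kurtosis F =
     (\<integral>y. (y - df_mean F) ^ 4 \<partial>interval_measure F) / df_sd F ^ 4"

(* Canonical realisation of an IID sequence with distribution function F. Probabilities of events
   about such a sequence depend on F only, so no arbitrary underlying space is quantified over. *)
definition iid_space :: "(real \<Rightarrow> real) \<Rightarrow> (nat \<Rightarrow> real) measure" where
  "iid_space F = (\<Pi>\<^sub>M i\<in>UNIV. interval_measure F)"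

(* A non-integrable function has Bochner integral 0, so the finiteness of the fourth moment
   (hence of the mean and the variance), implicit in a bounded kurtosis, is a separate condition. *)
definition admissible :: "real \<Rightarrow> real \<Rightarrow> (real \<Rightarrow> real) set" where
  "admissible \<kappa> \<sigma>_max =
     {F. distribution_function F \<and> integrable (interval_measure F) (\<lambda>y. y ^ 4) \<and>
         0 < df_sd F \<and> df_sd F \<le> \<sigma>_max \<and> modified_kurtosis F \<le> \<kappa>}"

(* The supremum is taken in the extended naturals, so that it exists without a boundedness
   hypothesis; it is 0 if no distribution is admissible. *)
definition prob_cost ::
    "nat \<Rightarrow> real \<Rightarrow> real \<Rightarrow> real \<Rightarrow> real \<Rightarrow> real \<Rightarrow> real \<Rightarrow> enat" where
  "prob_cost n\<^sub>\<sigma> C \<epsilon> \<alpha> \<beta> \<kappa> \<sigma>_max =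
     (SUP F\<in>admissible \<kappa> \<sigma>_max.
        enat (LEAST N. 1 \<le> N \<and>
          \<P>(Y in iid_space F. N_tot n\<^sub>\<sigma> C \<epsilon> \<alpha> \<kappa> Y \<le> N) \<ge> 1 - \<beta>))"

definition v_factor :: "real \<Rightarrow> real \<Rightarrow> real \<Rightarrow> real" where
  "v_factor \<alpha> \<beta> C =
     sqrt (C\<^sup>2 + (C\<^sup>2 - 1) * sqrt (\<alpha> * (1 - \<beta>) / ((1 - \<alpha>) * \<beta>)))"

definition N_up :: "nat \<Rightarrow> real \<Rightarrow> real \<Rightarrow> real \<Rightarrow> real \<Rightarrow> real \<Rightarrow> real \<Rightarrow> nat" where
  "N_up n\<^sub>\<sigma> C \<epsilon> \<alpha> \<beta> \<kappa> \<sigma>_max =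
     n\<^sub>\<sigma> + N_mu \<epsilon> (\<sigma>_max * v_factor (alpha_tilde \<alpha>) \<beta> C) (alpha_tilde \<alpha>) (\<kappa> powr (3/4))"

end

theory Submission
  imports Defs
begin

text \<open>
  The number of samples is a nondecreasing function of the estimate \<open>\<sigma>_hat\<close> produced by the
  first stage (\<open>N_mu_mono\<close>), so the \<open>(1 - \<beta>)\<close>-quantile of the cost is at most the cost at any
  number that \<open>\<sigma>_hat\<close> exceeds with probability at most \<open>\<beta>\<close>. It remains to see that
  \<open>\<sigma> v\<close>, and hence \<open>\<sigma>_max v\<close>, is such a number whenever \<open>F\<close> has standard deviation \<open>\<sigma>\<close> and
  kurtosis at most \<open>\<kappa>_max\<close> (\<open>sigma_hat_quantile_bound\<close>).

  The sample variance \<open>s\<^sup>2\<close> of \<open>n\<close> observations has mean \<open>\<sigma>\<^sup>2\<close> and variance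
  \<open>\<sigma>^4 / n * (\<kappa> - (n - 3) / (n - 1))\<close> (\<open>sample_variance_moments\<close>). The value of \<open>\<kappa>_max\<close> is made
  so that this variance is at most \<open>w = \<sigma>^4 * \<alpha> / (1 - \<alpha>) * (1 - 1/C\<^sup>2)\<^sup>2\<close>, where \<open>\<alpha>\<close> is the
  uncertainty allotted to each stage. The one-sided Chebyshev inequality of Cantelli,
  \<open>P (s\<^sup>2 - \<sigma>\<^sup>2 \<ge> t) \<le> w / (w + t\<^sup>2)\<close>, has right-hand side \<open>\<beta>\<close> when
  \<open>t\<^sup>2 = w (1 - \<beta>) / \<beta>\<close>, and for this \<open>t\<close> one has \<open>C\<^sup>2 (\<sigma>\<^sup>2 + t) = (\<sigma> v)\<^sup>2\<close>.

  The variance of \<open>s\<^sup>2\<close> is obtained from a martingale. With centred observations \<open>X i\<close>,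
  \<open>(n - 1) (s\<^sup>2 - \<sigma>\<^sup>2)\<close> is a combination of the diagonal sum \<open>\<Sum>i. (X i)\<^sup>2 - \<sigma>\<^sup>2\<close> and the
  off-diagonal sum \<open>\<Sum>i \<noteq> j. X i * X j\<close>. Adding one observation to such a combination adds
  an increment of conditional mean zero, so second moments of increments add up
  (\<open>quadratic_deviation_moments\<close>).
\<close>

section \<open>Moments of the sample variance\<close>

text \<open>
  The condition on \<open>restrict\<close> says that \<open>g\<close> reads only coordinates in \<open>A\<close>. It spares the users of
  the lemma all mention of restricted sequences.
\<close>

lemma (in prob_space) indep_vars_mult_disjoint:
  fixes X :: "'i \<Rightarrow> 'a \<Rightarrow> real" and g :: "('i \<Rightarrow> real) \<Rightarrow> real" and h :: "real \<Rightarrow> real"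
  assumes "indep_vars (\<lambda>_. borel) X J" "A \<subseteq> J" "k \<in> J" "k \<notin> A"
    and "g \<in> borel_measurable (PiM A (\<lambda>_. borel))" "h \<in> borel_measurable borel"
    and "\<And>x. g (restrict x A) = g x"
    and "integrable M (\<lambda>\<omega>. g (\<lambda>i. X i \<omega>))" "integrable M (\<lambda>\<omega>. h (X k \<omega>))"
  shows "integrable M (\<lambda>\<omega>. g (\<lambda>i. X i \<omega>) * h (X k \<omega>))"
    and "expectation (\<lambda>\<omega>. g (\<lambda>i. X i \<omega>) * h (X k \<omega>)) =
           expectation (\<lambda>\<omega>. g (\<lambda>i. X i \<omega>)) * expectation (\<lambda>\<omega>. h (X k \<omega>))"
proof -
  have "indep_var borel (g \<circ> (\<lambda>\<omega>. restrict (\<lambda>i. X i \<omega>) A))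
          borel ((\<lambda>x. h (x k)) \<circ> (\<lambda>\<omega>. restrict (\<lambda>i. X i \<omega>) {k}))"
    using assms by (intro indep_var_compose[OF indep_var_restrict[OF assms(1)]]) auto
  then have *: "indep_var borel (\<lambda>\<omega>. g (\<lambda>i. X i \<omega>)) borel (\<lambda>\<omega>. h (X k \<omega>))"
    using assms(7) by (simp add: comp_def)
  show "integrable M (\<lambda>\<omega>. g (\<lambda>i. X i \<omega>) * h (X k \<omega>))"
    using * assms(8,9) by (rule indep_var_integrable)
  show "expectation (\<lambda>\<omega>. g (\<lambda>i. X i \<omega>) * h (X k \<omega>)) =
           expectation (\<lambda>\<omega>. g (\<lambda>i. X i \<omega>)) * expectation (\<lambda>\<omega>. h (X k \<omega>))"
    using * assms(8,9) by (rule indep_var_lebesgue_integral)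
qed

lemma (in finite_measure) integrable_power_le_4:
  fixes f :: "'a \<Rightarrow> real"
  assumes "f \<in> borel_measurable M" "integrable M (\<lambda>x. f x ^ 4)" "k \<le> 4"
  shows "integrable M (\<lambda>x. f x ^ k)"
proof (rule Bochner_Integration.integrable_bound)
  show "integrable M (\<lambda>x. 1 + f x ^ 4)" using assms by simp
  have "\<bar>y\<bar> ^ k \<le> 1 + y ^ 4" for y :: real
  proof (cases "\<bar>y\<bar> \<le> 1")
    case True
    then have "\<bar>y\<bar> ^ k \<le> 1" by (simp add: power_le_one)
    then show ?thesis by (simp add: add_increasing2)
  next
    case False
    then have "\<bar>y\<bar> ^ k \<le> \<bar>y\<bar> ^ 4" using assms(3) by (intro power_increasing) auto
    then show ?thesis by simp
  qed
  then have "norm (f x ^ k) \<le> norm (1 + f x ^ 4)" for x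
    by (simp add: power_abs)
  then show "AE x in M. norm (f x ^ k) \<le> norm (1 + f x ^ 4)" by simp
qed (use assms in measurable)

text \<open>
  The second bracket is the off-diagonal sum of \<open>x i * x j\<close> over ordered pairs with \<open>i \<noteq> j\<close>.
  The weights \<open>a\<close> and \<open>b\<close> stay free, because the induction below enlarges \<open>A\<close> while the weights
  needed for the sample variance depend on its final size.
\<close>

definition quadratic_deviation :: "real \<Rightarrow> real \<Rightarrow> real \<Rightarrow> 'i set \<Rightarrow> ('i \<Rightarrow> real) \<Rightarrow> real" where
  "quadratic_deviation a b v A x =
     a * (\<Sum>i\<in>A. (x i)\<^sup>2 - v) - b * ((\<Sum>i\<in>A. x i)\<^sup>2 - (\<Sum>i\<in>A. (x i)\<^sup>2))"

lemma quadratic_deviation_insert: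
  assumes "finite A" "k \<notin> A"
  shows "quadratic_deviation a b v (insert k A) x =
           quadratic_deviation a b v A x + a * ((x k)\<^sup>2 - v) - 2 * b * (\<Sum>i\<in>A. x i) * x k"
  using assms by (simp add: quadratic_deviation_def) (simp add: power2_eq_square algebra_simps)

text \<open>
  Write \<open>S\<close> for the sum and \<open>D\<close> for the quadratic deviation of the variables in \<open>A\<close>. A further
  variable \<open>X\<close> adds \<open>a (X\<^sup>2 - v) - 2 b S X\<close> to \<open>D\<close>. As \<open>X\<close> is centred with second moment \<open>v\<close> and
  independent of \<open>A\<close>, this increment is orthogonal to \<open>D\<close> and its two parts are orthogonal to each
  other, so it contributes \<open>a\<^sup>2 (m - v\<^sup>2) + 4 b\<^sup>2 v * card A * v\<close>. Summing over
  \<open>card A = 0, 1, ...\<close> gives the formula.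
\<close>

lemma (in prob_space) quadratic_deviation_moments:
  fixes X :: "'i \<Rightarrow> 'a \<Rightarrow> real" and a b v m :: real
  assumes ind: "indep_vars (\<lambda>_. borel) X J"
    and int4: "\<And>i. i \<in> J \<Longrightarrow> integrable M (\<lambda>\<omega>. X i \<omega> ^ 4)"
    and m1: "\<And>i. i \<in> J \<Longrightarrow> expectation (X i) = 0"
    and m2: "\<And>i. i \<in> J \<Longrightarrow> expectation (\<lambda>\<omega>. (X i \<omega>)\<^sup>2) = v"
    and m4: "\<And>i. i \<in> J \<Longrightarrow> expectation (\<lambda>\<omega>. X i \<omega> ^ 4) = m"
    and A: "finite A" "A \<subseteq> J"
  defines "S \<equiv> \<lambda>A \<omega>. \<Sum>i\<in>A. X i \<omega>"
    and "D \<equiv> \<lambda>A \<omega>. quadratic_deviation a b v A (\<lambda>i. X i \<omega>)"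
  shows "integrable M (D A) \<and> integrable M (\<lambda>\<omega>. (D A \<omega>)\<^sup>2) \<and> expectation (D A) = 0 \<and>
         expectation (\<lambda>\<omega>. (D A \<omega>)\<^sup>2) =
           real (card A) * a\<^sup>2 * (m - v\<^sup>2) + 2 * b\<^sup>2 * v\<^sup>2 * real (card A) * (real (card A) - 1)"
proof -
  \<comment> \<open>The induction has to carry the moments of \<open>S\<close>, which enter the increment, and the
    integrability of \<open>D * S\<close>, which makes the cross term with \<open>D\<close> vanish.\<close>
  have "integrable M (S A) \<and> integrable M (\<lambda>\<omega>. (S A \<omega>)\<^sup>2) \<and> integrable M (\<lambda>\<omega>. D A \<omega> * S A \<omega>) \<and>
        expectation (S A) = 0 \<and> expectation (\<lambda>\<omega>. (S A \<omega>)\<^sup>2) = real (card A) * v \<and>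
        integrable M (D A) \<and> integrable M (\<lambda>\<omega>. (D A \<omega>)\<^sup>2) \<and> expectation (D A) = 0 \<and>
        expectation (\<lambda>\<omega>. (D A \<omega>)\<^sup>2) =
          real (card A) * a\<^sup>2 * (m - v\<^sup>2) + 2 * b\<^sup>2 * v\<^sup>2 * real (card A) * (real (card A) - 1)"
    using A
  proof (induction A rule: finite_induct)
    case empty
    then show ?case by (simp add: S_def D_def quadratic_deviation_def)
  next
    case (insert k A)
    then have A: "A \<subseteq> J" "k \<in> J" "k \<notin> A" "finite A" by auto
    note IH = insert.IH[OF A(1)]
    have X[measurable]: "X k \<in> borel_measurable M"
      using ind A(2) by (simp add: indep_vars_def2)
    have pow: "integrable M (\<lambda>\<omega>. X k \<omega> ^ j)" if "j \<le> 4" for j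
      using integrable_power_le_4[OF X int4 that] A by simp
    define U where "U = (\<lambda>x. x\<^sup>2 - v)"
    define s where "s = (\<lambda>x::'i \<Rightarrow> real. \<Sum>i\<in>A. x i)"
    define d where "d = (quadratic_deviation a b v A :: ('i \<Rightarrow> real) \<Rightarrow> real)"
    have U_meas[measurable]: "U \<in> borel_measurable borel"
      unfolding U_def by measurable
    have s_meas[measurable]: "s \<in> borel_measurable (PiM A (\<lambda>_. borel))"
      unfolding s_def by measurable
    have d_meas[measurable]: "d \<in> borel_measurable (PiM A (\<lambda>_. borel))"
      unfolding d_def quadratic_deviation_def by measurable
    have s_restrict: "s (restrict x A) = s x" for x
      by (simp add: s_def)
    have d_restrict: "d (restrict x A) = d x" for x
      by (simp add: d_def quadratic_deviation_def)
    have SA: "S A = (\<lambda>\<omega>. s (\<lambda>i. X i \<omega>))" and DA: "D A = (\<lambda>\<omega>. d (\<lambda>i. X i \<omega>))"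
      by (simp_all add: S_def D_def s_def d_def)
    have S': "S (insert k A) = (\<lambda>\<omega>. S A \<omega> + X k \<omega>)"
      using A by (simp add: S_def add.commute)
    have D': "D (insert k A) = (\<lambda>\<omega>. D A \<omega> + a * U (X k \<omega>) - 2 * b * (S A \<omega> * X k \<omega>))"
      using A by (simp add: S_def D_def U_def quadratic_deviation_insert mult.assoc)
    have "integrable M (\<lambda>\<omega>. X k \<omega>)" "integrable M (\<lambda>\<omega>. (X k \<omega>)\<^sup>2)"
      using pow[of 1] pow[of 2] by simp_all
    moreover have "integrable M (\<lambda>\<omega>. U (X k \<omega>))"
      unfolding U_def using pow[of 2] by simp
    moreover have "(\<lambda>\<omega>. (U (X k \<omega>))\<^sup>2) = (\<lambda>\<omega>. X k \<omega> ^ 4 - 2 * v * (X k \<omega>)\<^sup>2 + v\<^sup>2)"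
      unfolding U_def by (simp add: power2_eq_square power4_eq_xxxx algebra_simps)
    moreover have "integrable M (\<lambda>\<omega>. X k \<omega> ^ 4 - 2 * v * (X k \<omega>)\<^sup>2 + v\<^sup>2)"
      using pow[of 4] pow[of 2] by simp
    moreover have "expectation (\<lambda>\<omega>. X k \<omega> ^ 4 - 2 * v * (X k \<omega>)\<^sup>2 + v\<^sup>2) = m - v\<^sup>2"
      using pow[of 4] pow[of 2] m2[OF A(2)] m4[OF A(2)] by (simp add: prob_space power2_eq_square)
    moreover have "(\<lambda>\<omega>. U (X k \<omega>) * X k \<omega>) = (\<lambda>\<omega>. X k \<omega> ^ 3 - v * X k \<omega> ^ 1)"
      unfolding U_def by (simp add: power2_eq_square power3_eq_cube algebra_simps)
    moreover have "integrable M (\<lambda>\<omega>. X k \<omega> ^ 3 - v * X k \<omega> ^ 1)"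
      using pow[of 3] pow[of 1] by simp
    moreover have "expectation (\<lambda>\<omega>. U (X k \<omega>)) = 0"
      unfolding U_def using pow[of 2] m2[OF A(2)] by (simp add: prob_space)
    ultimately have single:
      "integrable M (\<lambda>\<omega>. X k \<omega>)" "integrable M (\<lambda>\<omega>. (X k \<omega>)\<^sup>2)"
      "integrable M (\<lambda>\<omega>. U (X k \<omega>))" "integrable M (\<lambda>\<omega>. (U (X k \<omega>))\<^sup>2)"
      "integrable M (\<lambda>\<omega>. U (X k \<omega>) * X k \<omega>)"
      "expectation (\<lambda>\<omega>. U (X k \<omega>)) = 0" "expectation (\<lambda>\<omega>. (U (X k \<omega>))\<^sup>2) = m - v\<^sup>2"
      by simp_all
    note ind_mult = indep_vars_mult_disjoint[OF ind A(1,2,3)]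
    note past = IH[unfolded SA DA]
    note DU = ind_mult[of d U, OF d_meas U_meas d_restrict]
    note SX = ind_mult[of s "\<lambda>y. y", OF s_meas _ s_restrict]
    note DX = ind_mult[of d "\<lambda>y. y", OF d_meas _ d_restrict]
    note SU = ind_mult[of s U, OF s_meas U_meas s_restrict]
    note SUX = ind_mult[of s "\<lambda>y. U y * y", OF s_meas _ s_restrict]
    note SSX = ind_mult[of "\<lambda>x. (s x)\<^sup>2" "\<lambda>y. y"]
    note SXX = ind_mult[of s "\<lambda>y. y\<^sup>2", OF s_meas _ s_restrict]
    note SSXX = ind_mult[of "\<lambda>x. (s x)\<^sup>2" "\<lambda>y. y\<^sup>2"]
    note DSX = ind_mult[of "\<lambda>x. d x * s x" "\<lambda>y. y"]
    \<comment> \<open>Each monomial in the expansions of the new moments is a function of the variables in \<open>A\<close>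
      times a function of the new variable.\<close>
    have prods:
      "integrable M (\<lambda>\<omega>. D A \<omega> * U (X k \<omega>))" "expectation (\<lambda>\<omega>. D A \<omega> * U (X k \<omega>)) = 0"
      "integrable M (\<lambda>\<omega>. S A \<omega> * X k \<omega>)" "expectation (\<lambda>\<omega>. S A \<omega> * X k \<omega>) = 0"
      "integrable M (\<lambda>\<omega>. D A \<omega> * X k \<omega>)"
      "integrable M (\<lambda>\<omega>. S A \<omega> * U (X k \<omega>))"
      "integrable M (\<lambda>\<omega>. S A \<omega> * (U (X k \<omega>) * X k \<omega>))"
      "expectation (\<lambda>\<omega>. S A \<omega> * (U (X k \<omega>) * X k \<omega>)) = 0"
      "integrable M (\<lambda>\<omega>. (S A \<omega>)\<^sup>2 * X k \<omega>)"
      "integrable M (\<lambda>\<omega>. S A \<omega> * (X k \<omega>)\<^sup>2)"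
      "integrable M (\<lambda>\<omega>. (S A \<omega>)\<^sup>2 * (X k \<omega>)\<^sup>2)"
      "expectation (\<lambda>\<omega>. (S A \<omega>)\<^sup>2 * (X k \<omega>)\<^sup>2) = real (card A) * v * v"
      "integrable M (\<lambda>\<omega>. D A \<omega> * S A \<omega> * X k \<omega>)"
      "expectation (\<lambda>\<omega>. D A \<omega> * S A \<omega> * X k \<omega>) = 0"
      unfolding SA DA
      using past single m1[OF A(2)] m2[OF A(2)]
      by (simp_all add: DU SX DX SU SUX SSX SXX SSXX DSX s_restrict d_restrict)
    have S2: "(\<lambda>\<omega>. (S A \<omega> + X k \<omega>)\<^sup>2) = (\<lambda>\<omega>. (S A \<omega>)\<^sup>2 + 2 * (S A \<omega> * X k \<omega>) + (X k \<omega>)\<^sup>2)"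
      by (simp add: power2_eq_square algebra_simps)
    have DS: "(\<lambda>\<omega>. (D A \<omega> + a * U (X k \<omega>) - 2 * b * (S A \<omega> * X k \<omega>)) * (S A \<omega> + X k \<omega>)) =
      (\<lambda>\<omega>. D A \<omega> * S A \<omega> + D A \<omega> * X k \<omega> + a * (S A \<omega> * U (X k \<omega>)) + a * (U (X k \<omega>) * X k \<omega>)
        - 2 * b * ((S A \<omega>)\<^sup>2 * X k \<omega>) - 2 * b * (S A \<omega> * (X k \<omega>)\<^sup>2))"
      by (simp add: power2_eq_square algebra_simps)
    have D2: "(\<lambda>\<omega>. (D A \<omega> + a * U (X k \<omega>) - 2 * b * (S A \<omega> * X k \<omega>))\<^sup>2) =
      (\<lambda>\<omega>. (D A \<omega>)\<^sup>2 + 2 * a * (D A \<omega> * U (X k \<omega>)) - 4 * b * (D A \<omega> * S A \<omega> * X k \<omega>)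
        + a\<^sup>2 * (U (X k \<omega>))\<^sup>2 - 4 * a * b * (S A \<omega> * (U (X k \<omega>) * X k \<omega>))
        + 4 * b\<^sup>2 * ((S A \<omega>)\<^sup>2 * (X k \<omega>)\<^sup>2))"
      by (simp add: power2_eq_square algebra_simps)
    let ?D2 = "\<lambda>\<omega>. (D A \<omega>)\<^sup>2 + 2 * a * (D A \<omega> * U (X k \<omega>)) - 4 * b * (D A \<omega> * S A \<omega> * X k \<omega>)
        + a\<^sup>2 * (U (X k \<omega>))\<^sup>2 - 4 * a * b * (S A \<omega> * (U (X k \<omega>) * X k \<omega>))
        + 4 * b\<^sup>2 * ((S A \<omega>)\<^sup>2 * (X k \<omega>)\<^sup>2)"
    have int_D2: "integrable M ?D2"
      using IH prods single by simp
    have E_D2: "expectation ?D2 = expectation (\<lambda>\<omega>. (D A \<omega>)\<^sup>2) + a\<^sup>2 * (m - v\<^sup>2)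
        + 4 * b\<^sup>2 * (real (card A) * v * v)"
      using IH prods single by simp
    have card: "card (insert k A) = Suc (card A)" using A by simp
    have "integrable M (S (insert k A))" "integrable M (\<lambda>\<omega>. (S (insert k A) \<omega>)\<^sup>2)"
      "integrable M (\<lambda>\<omega>. D (insert k A) \<omega> * S (insert k A) \<omega>)"
      "expectation (S (insert k A)) = 0"
      "expectation (\<lambda>\<omega>. (S (insert k A) \<omega>)\<^sup>2) = real (card (insert k A)) * v"
      "integrable M (D (insert k A))" "integrable M (\<lambda>\<omega>. (D (insert k A) \<omega>)\<^sup>2)"
      "expectation (D (insert k A)) = 0"
      unfolding S' D' S2 DS D2 card
      using IH prods single int_D2 m1[OF A(2)] m2[OF A(2)] by (simp_all add: distrib_right)
    moreover have "expectation (\<lambda>\<omega>. (D (insert k A) \<omega>)\<^sup>2) =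
        real (card (insert k A)) * a\<^sup>2 * (m - v\<^sup>2)
          + 2 * b\<^sup>2 * v\<^sup>2 * real (card (insert k A)) * (real (card (insert k A)) - 1)"
    proof -
      have "expectation (\<lambda>\<omega>. (D A \<omega>)\<^sup>2) =
          real (card A) * a\<^sup>2 * (m - v\<^sup>2) + 2 * b\<^sup>2 * v\<^sup>2 * real (card A) * (real (card A) - 1)"
        using IH by blast
      then show ?thesis
        unfolding D' D2 E_D2 card by (simp add: algebra_simps power2_eq_square)
    qed
    ultimately show ?case by blast
  qed
  then show ?thesis by simp
qed


text \<open>
  The sample variance is invariant under translation by \<open>\<mu>\<close>. For the shifted values \<open>x\<close> with sum \<open>S\<close>
  it is \<open>((\<Sum>i. (x i)\<^sup>2) - S\<^sup>2 / n) / (n - 1)\<close>, and splitting \<open>S\<^sup>2\<close> into diagonal and off-diagonal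
  terms leaves the weight \<open>1 - 1/n\<close> on the squares.
\<close>

lemma sample_variance_eq_quadratic_deviation:
  fixes y :: "nat \<Rightarrow> real"
  assumes "2 \<le> n"
  shows "(real n - 1) * (sample_variance n y - v) =
           quadratic_deviation (1 - 1 / real n) (1 / real n) v {1..n} (\<lambda>i. y i - \<mu>)"
proof -
  define x where "x = (\<lambda>i. y i - \<mu>)"
  define S where "S = (\<Sum>i=1..n. x i)"
  have n: "real n \<noteq> 0" "real n - 1 \<noteq> 0" using assms by auto
  have y: "y = (\<lambda>i. x i + \<mu>)" by (simp add: x_def)
  have "(\<Sum>j=1..n. y j) / real n = S / real n + \<mu>"
    using n by (simp add: y S_def sum.distrib field_simps)
  then have dev: "y i - (\<Sum>j=1..n. y j) / real n = x i - S / real n" for i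
    by (simp add: y)
  have "(real n - 1) * sample_variance n y = (\<Sum>i=1..n. (x i - S / real n)\<^sup>2)"
    unfolding sample_variance_def dev using n by simp
  also have "\<dots> = (\<Sum>i=1..n. (x i)\<^sup>2 - 2 * (S / real n) * x i + (S / real n)\<^sup>2)"
    by (intro sum.cong) (simp_all add: power2_eq_square algebra_simps)
  also have "\<dots> = (\<Sum>i=1..n. (x i)\<^sup>2) - 2 * (S / real n) * S + real n * (S / real n)\<^sup>2"
    by (simp add: sum.distrib sum_subtractf sum_distrib_left S_def)
  also have "\<dots> = (\<Sum>i=1..n. (x i)\<^sup>2) - S\<^sup>2 / real n"
    using n by (simp add: power2_eq_square field_simps)
  finally have *: "(real n - 1) * sample_variance n y = (\<Sum>i=1..n. (x i)\<^sup>2) - S\<^sup>2 / real n" .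
  have "quadratic_deviation (1 - 1 / real n) (1 / real n) v {1..n} x =
      (1 - 1 / real n) * ((\<Sum>i=1..n. (x i)\<^sup>2) - real n * v)
        - 1 / real n * (S\<^sup>2 - (\<Sum>i=1..n. (x i)\<^sup>2))"
    by (simp add: quadratic_deviation_def S_def sum_subtractf)
  also have "\<dots> = (\<Sum>i=1..n. (x i)\<^sup>2) - S\<^sup>2 / real n - (real n - 1) * v"
    using n by (simp add: field_simps)
  finally show ?thesis
    using * by (simp add: x_def right_diff_distrib)
qed

lemma (in prob_space) sample_variance_moments:
  fixes Y :: "nat \<Rightarrow> 'a \<Rightarrow> real" and \<mu> v m :: real
  assumes ind: "indep_vars (\<lambda>_. borel) Y UNIV"
    and int4: "\<And>i. integrable M (\<lambda>\<omega>. (Y i \<omega> - \<mu>) ^ 4)"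
    and m1: "\<And>i. expectation (\<lambda>\<omega>. Y i \<omega> - \<mu>) = 0"
    and m2: "\<And>i. expectation (\<lambda>\<omega>. (Y i \<omega> - \<mu>)\<^sup>2) = v"
    and m4: "\<And>i. expectation (\<lambda>\<omega>. (Y i \<omega> - \<mu>) ^ 4) = m"
    and n: "2 \<le> n"
  defines "Z \<equiv> \<lambda>\<omega>. sample_variance n (\<lambda>i. Y i \<omega>) - v"
  shows "integrable M Z" "integrable M (\<lambda>\<omega>. (Z \<omega>)\<^sup>2)" "expectation Z = 0"
    and "expectation (\<lambda>\<omega>. (Z \<omega>)\<^sup>2) = (m - (real n - 3) / (real n - 1) * v\<^sup>2) / real n"
proof -
  define D where "D = (\<lambda>\<omega>. quadratic_deviation (1 - 1 / real n) (1 / real n) v {1..n}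
    (\<lambda>i. Y i \<omega> - \<mu>))"
  have n1: "real n \<noteq> 0" "real n - 1 \<noteq> 0" using n by auto
  have "indep_vars (\<lambda>_. borel) (\<lambda>i \<omega>. Y i \<omega> - \<mu>) UNIV"
    by (rule indep_vars_compose2[OF ind]) simp
  from quadratic_deviation_moments[OF this int4 m1 m2 m4, of "{1..n}" "1 - 1 / real n" "1 / real n"]
  have D: "integrable M D" "integrable M (\<lambda>\<omega>. (D \<omega>)\<^sup>2)" "expectation D = 0"
    "expectation (\<lambda>\<omega>. (D \<omega>)\<^sup>2) = real n * (1 - 1 / real n)\<^sup>2 * (m - v\<^sup>2)
       + 2 * (1 / real n)\<^sup>2 * v\<^sup>2 * real n * (real n - 1)"
    unfolding D_def by simp_all
  have Z: "Z = (\<lambda>\<omega>. D \<omega> / (real n - 1))"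
    unfolding Z_def D_def sample_variance_eq_quadratic_deviation[OF n, symmetric]
    using n1 by simp
  show "integrable M Z" "integrable M (\<lambda>\<omega>. (Z \<omega>)\<^sup>2)" "expectation Z = 0"
    using D by (simp_all add: Z power_divide)
  have "expectation (\<lambda>\<omega>. (Z \<omega>)\<^sup>2) = (real n * (1 - 1 / real n)\<^sup>2 * (m - v\<^sup>2)
       + 2 * (1 / real n)\<^sup>2 * v\<^sup>2 * real n * (real n - 1)) / (real n - 1)\<^sup>2"
    using D by (simp add: Z power_divide)
  also have "\<dots> = (m - (real n - 3) / (real n - 1) * v\<^sup>2) / real n"
  proof -
    have "1 - 1 / real n = (real n - 1) / real n" using n1 by (simp add: field_simps)
    then show ?thesis
      using n1 by (simp add: divide_simps) (simp add: power2_eq_square algebra_simps)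
  qed
  finally show "expectation (\<lambda>\<omega>. (Z \<omega>)\<^sup>2) = (m - (real n - 3) / (real n - 1) * v\<^sup>2) / real n" .
qed

section \<open>Cantelli's inequality\<close>

text \<open>
  For any \<open>u \<ge> 0\<close>, Markov's inequality for \<open>(Z + u)\<^sup>2\<close> bounds the probability by
  \<open>(w + u\<^sup>2) / (t + u)\<^sup>2\<close>. The choice \<open>u = w / t\<close> minimises this bound.
\<close>

lemma (in prob_space) Cantelli_inequality:
  fixes Z :: "'a \<Rightarrow> real"
  assumes "integrable M Z" "integrable M (\<lambda>\<omega>. (Z \<omega>)\<^sup>2)" "expectation Z = 0"
    and w: "expectation (\<lambda>\<omega>. (Z \<omega>)\<^sup>2) \<le> w" and t: "0 < t"
  shows "\<P>(\<omega> in M. t \<le> Z \<omega>) \<le> w / (w + t\<^sup>2)"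
proof -
  have [measurable]: "Z \<in> borel_measurable M" using assms(1) by simp
  have "0 \<le> expectation (\<lambda>\<omega>. (Z \<omega>)\<^sup>2)" by simp
  with w have w0: "0 \<le> w" by linarith
  define u where "u = w / t"
  have u0: "0 \<le> u" using w0 t by (simp add: u_def)
  have shift: "(\<lambda>\<omega>. (Z \<omega> + u)\<^sup>2) = (\<lambda>\<omega>. (Z \<omega>)\<^sup>2 + 2 * u * Z \<omega> + u\<^sup>2)"
    by (simp add: power2_eq_square algebra_simps)
  have int: "integrable M (\<lambda>\<omega>. (Z \<omega> + u)\<^sup>2)" unfolding shift using assms by simp
  have "{\<omega> \<in> space M. t \<le> Z \<omega>} \<subseteq> {\<omega> \<in> space M. (t + u)\<^sup>2 \<le> (Z \<omega> + u)\<^sup>2}"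
    using t u0 by (auto intro!: power_mono)
  then have "\<P>(\<omega> in M. t \<le> Z \<omega>) \<le> \<P>(\<omega> in M. (t + u)\<^sup>2 \<le> (Z \<omega> + u)\<^sup>2)"
    by (intro finite_measure_mono) auto
  also have "\<dots> \<le> expectation (\<lambda>\<omega>. (Z \<omega> + u)\<^sup>2) / (t + u)\<^sup>2"
    using int t u0 by (intro integral_Markov_inequality_measure[where A = "{}"]) auto
  also have "expectation (\<lambda>\<omega>. (Z \<omega> + u)\<^sup>2) = expectation (\<lambda>\<omega>. (Z \<omega>)\<^sup>2) + u\<^sup>2"
    unfolding shift using assms by (simp add: prob_space)
  also have "(expectation (\<lambda>\<omega>. (Z \<omega>)\<^sup>2) + u\<^sup>2) / (t + u)\<^sup>2 \<le> (w + u\<^sup>2) / (t + u)\<^sup>2"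
    using w by (intro divide_right_mono) auto
  also have "\<dots> = w / (w + t\<^sup>2)"
  proof -
    have "w + u\<^sup>2 = w * (w + t\<^sup>2) / t\<^sup>2"
      using t by (simp add: u_def field_simps power2_eq_square)
    moreover have "(t + u)\<^sup>2 = (w + t\<^sup>2)\<^sup>2 / t\<^sup>2"
      using t by (simp add: u_def field_simps power2_eq_square)
    moreover have "w + t\<^sup>2 > 0" using w0 t by (simp add: add_nonneg_pos)
    ultimately show ?thesis using t by (simp add: power2_eq_square)
  qed
  finally show ?thesis .
qed

section \<open>Monotonicity of the sample size\<close>

lemma Phi_mono: "x \<le> y \<Longrightarrow> Phi x \<le> Phi y"
proof -
  interpret real_distribution std_normal_distribution by (rule real_dist_normal_dist)
  show "x \<le> y \<Longrightarrow> Phi x \<le> Phi y" by (simp add: Phi_def cdf_nondecreasing)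
qed

lemma Delta_antimono:
  assumes "0 \<le> x" "x \<le> y" "0 \<le> M"
  shows "Delta n y M \<le> Delta n x M"
proof -
  have "\<bar>x\<bar> ^ 3 \<le> \<bar>y\<bar> ^ 3" using assms by (intro power_mono) auto
  then have "18.1139 * M / (1 + \<bar>y\<bar> ^ 3) \<le> 18.1139 * M / (1 + \<bar>x\<bar> ^ 3)"
    using assms by (intro divide_left_mono mult_pos_pos) (auto intro!: add_pos_nonneg)
  then show ?thesis
    unfolding Delta_def by (intro mult_left_mono min.mono) auto
qed

text \<open>
  Without this, the least element in \<open>N_BE\<close> could be an arbitrary number. The Gaussian tail vanishes as
  \<open>n\<close> grows, and so does the uniform part of \<open>Delta\<close>, which is of order \<open>1 / sqrt n\<close>.
\<close>

lemma N_BE_condition_satisfiable: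
  assumes "0 < \<epsilon>" "0 < \<sigma>" "0 < \<alpha>"
  shows "\<exists>n. 1 \<le> n \<and>
    Phi (- sqrt (real n) * \<epsilon> / \<sigma>) + Delta n (sqrt (real n) * \<epsilon> / \<sigma>) M \<le> \<alpha> / 2"
proof -
  interpret real_distribution std_normal_distribution by (rule real_dist_normal_dist)
  have "filterlim (\<lambda>n. sqrt (real n) * (\<epsilon> / \<sigma>)) at_top sequentially"
    using assms
    by (intro filterlim_at_top_mult_tendsto_pos[OF tendsto_const]
         filterlim_compose[OF sqrt_at_top] filterlim_real_sequentially) simp_all
  then have "filterlim (\<lambda>n. - (sqrt (real n) * (\<epsilon> / \<sigma>))) at_bot sequentially"
    by (simp add: filterlim_uminus_at_top)
  then have "(\<lambda>n. Phi (- sqrt (real n) * \<epsilon> / \<sigma>)) \<longlonglongrightarrow> 0"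
    unfolding Phi_def using filterlim_compose[OF cdf_lim_at_bot] by (simp add: mult.assoc)
  moreover have "(\<lambda>n. 1 / sqrt (real n) * (0.3328 * (M + 0.429))) \<longlonglongrightarrow> 0"
    by (intro tendsto_mult_left_zero tendsto_divide_0[OF tendsto_const]
         filterlim_at_top_imp_at_infinity filterlim_compose[OF sqrt_at_top]
         filterlim_real_sequentially)
  ultimately have "(\<lambda>n. Phi (- sqrt (real n) * \<epsilon> / \<sigma>)
      + 1 / sqrt (real n) * (0.3328 * (M + 0.429))) \<longlonglongrightarrow> 0 + 0"
    by (rule tendsto_add)
  then have "\<forall>\<^sub>F n in sequentially. Phi (- sqrt (real n) * \<epsilon> / \<sigma>)
      + 1 / sqrt (real n) * (0.3328 * (M + 0.429)) < \<alpha> / 2"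
    using assms by (intro order_tendstoD(2)) auto
  then have "\<forall>\<^sub>F n in sequentially. 1 \<le> n \<and> Phi (- sqrt (real n) * \<epsilon> / \<sigma>)
      + 1 / sqrt (real n) * (0.3328 * (M + 0.429)) < \<alpha> / 2"
    using eventually_ge_at_top[of 1] by eventually_elim simp
  then obtain n where n: "1 \<le> n" "Phi (- sqrt (real n) * \<epsilon> / \<sigma>)
      + 1 / sqrt (real n) * (0.3328 * (M + 0.429)) < \<alpha> / 2"
    using eventually_happens by (metis (no_types, lifting) sequentially_bot)
  have "Delta n (sqrt (real n) * \<epsilon> / \<sigma>) M \<le> 1 / sqrt (real n) * (0.3328 * (M + 0.429))"
    unfolding Delta_def by (intro mult_left_mono min.cobounded1) auto
  with n show ?thesis by (intro exI[of _ n]) linarith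
qed

text \<open>
  Lowering \<open>\<sigma>\<close> raises \<open>sqrt n * \<epsilon> / \<sigma>\<close>, at which both summands of the condition decrease. So an \<open>n\<close>
  that is large enough for \<open>\<sigma>'\<close> is large enough for \<open>\<sigma>\<close>.
\<close>

lemma N_BE_mono:
  assumes "0 < \<epsilon>" "0 < \<sigma>" "\<sigma> \<le> \<sigma>'" "0 < \<alpha>" "0 \<le> M"
  shows "N_BE \<epsilon> \<sigma> \<alpha> M \<le> N_BE \<epsilon> \<sigma>' \<alpha> M"
proof -
  let ?n = "N_BE \<epsilon> \<sigma>' \<alpha> M"
  have n: "1 \<le> ?n"
    "Phi (- sqrt (real ?n) * \<epsilon> / \<sigma>') + Delta ?n (sqrt (real ?n) * \<epsilon> / \<sigma>') M \<le> \<alpha> / 2"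
    using LeastI_ex[OF N_BE_condition_satisfiable[of \<epsilon> \<sigma>' \<alpha> M]] assms
    unfolding N_BE_def[symmetric] by auto
  have x: "sqrt (real ?n) * \<epsilon> / \<sigma>' \<le> sqrt (real ?n) * \<epsilon> / \<sigma>"
    using assms by (intro divide_left_mono mult_pos_pos) auto
  have "Phi (- sqrt (real ?n) * \<epsilon> / \<sigma>) \<le> Phi (- sqrt (real ?n) * \<epsilon> / \<sigma>')"
    using x by (intro Phi_mono) simp
  moreover have "Delta ?n (sqrt (real ?n) * \<epsilon> / \<sigma>) M \<le> Delta ?n (sqrt (real ?n) * \<epsilon> / \<sigma>') M"
    using x assms by (intro Delta_antimono) auto
  ultimately show ?thesis
    using n by (subst N_BE_def) (intro Least_le; simp)
qed

lemma N_mu_mono: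
  assumes "0 < \<epsilon>" "0 \<le> \<sigma>" "\<sigma> \<le> \<sigma>'" "0 < \<alpha>" "0 \<le> M"
  shows "N_mu \<epsilon> \<sigma> \<alpha> M \<le> N_mu \<epsilon> \<sigma>' \<alpha> M"
proof (cases "\<sigma> = 0")
  case False
  then have "0 < \<sigma>" using assms by simp
  have "N_Cheb \<epsilon> \<sigma> \<alpha> \<le> N_Cheb \<epsilon> \<sigma>' \<alpha>"
    unfolding N_Cheb_def using assms
    by (intro nat_mono ceiling_mono divide_right_mono power_mono) auto
  moreover have "N_BE \<epsilon> \<sigma> \<alpha> M \<le> N_BE \<epsilon> \<sigma>' \<alpha> M"
    using \<open>0 < \<sigma>\<close> assms by (intro N_BE_mono) auto
  ultimately show ?thesis
    using \<open>0 < \<sigma>\<close> assms by (auto simp: N_mu_def intro!: max.mono min.mono)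
qed (simp add: N_mu_def)

section \<open>The cost bound\<close>

lemma distribution_function_real_distribution:
  "distribution_function F \<Longrightarrow> real_distribution (interval_measure F)"
  unfolding distribution_function_def
  by (intro real_distribution_interval_measure) (auto dest: monoD)

lemma PiM_coordinates_iid:
  fixes N :: "real measure"
  assumes "prob_space N" "sets N = sets borel"
  shows "prob_space.indep_vars (\<Pi>\<^sub>M i\<in>(UNIV :: nat set). N) (\<lambda>_. borel) (\<lambda>i x. x i) UNIV"
    and "distr (\<Pi>\<^sub>M i\<in>(UNIV :: nat set). N) borel (\<lambda>x. x i) = N"
proof -
  let ?P = "\<Pi>\<^sub>M i\<in>(UNIV :: nat set). N"
  interpret P: prob_space ?P using assms by (intro prob_space_PiM)
  have distr: "distr ?P borel (\<lambda>x. x i) = N" for i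
  proof -
    have "distr ?P borel (\<lambda>x. x i) = distr ?P N (\<lambda>x. x i)"
      using assms by (intro distr_cong) auto
    then show ?thesis using assms distr_PiM_component[of UNIV "\<lambda>_. N" i] by simp
  qed
  show "distr ?P borel (\<lambda>x. x i) = N" by (rule distr)
  have sets: "sets (\<Pi>\<^sub>M i\<in>(UNIV :: nat set). (borel :: real measure)) = sets ?P"
    using assms by (intro sets_PiM_cong) auto
  have rv: "(\<lambda>x. x i) \<in> borel_measurable ?P" for i
    using assms by (simp cong: measurable_cong_sets)
  have "distr ?P (\<Pi>\<^sub>M i\<in>(UNIV :: nat set). (borel :: real measure)) (\<lambda>x. x) = ?P"
    using sets by (intro distr_id2)
  then show "P.indep_vars (\<lambda>_. borel) (\<lambda>i x. x i) UNIV"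
    by (subst P.indep_vars_iff_distr_eq_PiM[OF _ rv]) (simp_all add: distr restrict_UNIV)
qed


lemma sample_variance_nonneg: "2 \<le> n \<Longrightarrow> 0 \<le> sample_variance n y"
  unfolding sample_variance_def by (intro divide_nonneg_nonneg sum_nonneg) auto

lemma sigma_hat_measurable:
  assumes "\<And>i. (\<lambda>x. x i) \<in> borel_measurable M"
  shows "sigma_hat n C \<in> borel_measurable M"
proof -
  note [measurable] = assms
  show ?thesis unfolding sigma_hat_def sample_variance_def by measurable
qed

text \<open>
  Here the value of \<open>kappa_max\<close> is matched with Cantelli's inequality. With \<open>q = 1 - 1/C\<^sup>2\<close> the
  variance of the sample variance is at most \<open>w\<close>. The deviation \<open>t\<close> is the one for which
  \<open>w / (w + t\<^sup>2) = \<beta>\<close>.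
\<close>

lemma sigma_hat_quantile_bound:
  fixes \<alpha> \<beta> C \<sigma>_max :: real
  assumes n: "2 \<le> n" and C: "1 < C" and \<alpha>: "0 < \<alpha>" "\<alpha> < 1" and \<beta>: "0 < \<beta>" "\<beta> < 1"
    and F: "F \<in> admissible (kappa_max \<alpha> n C) \<sigma>_max"
  shows "1 - \<beta> \<le> \<P>(Y in iid_space F. sigma_hat n C Y \<le> \<sigma>_max * v_factor \<alpha> \<beta> C)"
proof -
  let ?N = "interval_measure F"
  define \<mu> where "\<mu> = df_mean F"
  define v where "v = (df_sd F)\<^sup>2"
  define m where "m = (\<integral>y. (y - \<mu>) ^ 4 \<partial>?N)"
  have F': "distribution_function F" "integrable ?N (\<lambda>y. y ^ 4)" "0 < df_sd F" "df_sd F \<le> \<sigma>_max"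
    "modified_kurtosis F \<le> kappa_max \<alpha> n C"
    using F by (auto simp: admissible_def)
  interpret N: real_distribution ?N
    using F'(1) by (rule distribution_function_real_distribution)
  let ?P = "\<Pi>\<^sub>M i\<in>(UNIV :: nat set). ?N"
  interpret P: prob_space ?P by (intro prob_space_PiM N.prob_space_axioms)
  have P: "iid_space F = ?P" by (simp add: iid_space_def)
  have sets: "sets ?N = sets borel" by simp
  note comp = PiM_coordinates_iid[OF N.prob_space_axioms sets]
  have rv[measurable]: "(\<lambda>x. x i) \<in> borel_measurable ?P" for i
    using sets by (simp cong: measurable_cong_sets)

  have pow: "integrable ?N (\<lambda>y. y ^ k)" if "k \<le> 4" for k
    using N.integrable_power_le_4[of "\<lambda>y. y" k] F'(2) that by simp
  have "(\<lambda>y::real. (y - \<mu>) ^ 4) =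
      (\<lambda>y. y ^ 4 - 4 * \<mu> * y ^ 3 + 6 * \<mu>\<^sup>2 * y ^ 2 - 4 * \<mu> ^ 3 * y ^ 1 + \<mu> ^ 4)"
    by (simp add: power2_eq_square power3_eq_cube power4_eq_xxxx algebra_simps)
  then have int4: "integrable ?N (\<lambda>y. (y - \<mu>) ^ 4)"
    using pow[of 1] pow[of 2] pow[of 3] pow[of 4] by simp
  have m1: "(\<integral>y. y - \<mu> \<partial>?N) = 0"
    using pow[of 1] N.prob_space by (simp add: \<mu>_def df_mean_def)
  have m2: "(\<integral>y. (y - \<mu>)\<^sup>2 \<partial>?N) = v"
    using F'(3) by (simp add: v_def df_sd_def \<mu>_def)
  have v: "0 < v" using F'(3) by (simp add: v_def)
  have m_le: "m \<le> kappa_max \<alpha> n C * v\<^sup>2"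
  proof -
    have "df_sd F ^ 4 = v\<^sup>2" by (simp add: v_def flip: power_mult)
    then show ?thesis
      using F'(5) v by (simp add: modified_kurtosis_def m_def \<mu>_def divide_le_eq)
  qed

  have transfer: "integrable ?P (\<lambda>x. f (x i)) \<longleftrightarrow> integrable ?N f"
    "P.expectation (\<lambda>x. f (x i)) = (\<integral>y. f y \<partial>?N)"
    if "f \<in> borel_measurable borel" for f :: "real \<Rightarrow> real" and i
    using integrable_distr_eq[OF rv that, of i] integral_distr[OF rv that, of i] comp(2)[of i]
    by simp_all
  define Z where "Z = (\<lambda>Y. sample_variance n Y - v)"
  have "integrable ?P (\<lambda>Y. (Y i - \<mu>) ^ 4)" "P.expectation (\<lambda>Y. Y i - \<mu>) = 0"
    "P.expectation (\<lambda>Y. (Y i - \<mu>)\<^sup>2) = v" "P.expectation (\<lambda>Y. (Y i - \<mu>) ^ 4) = m" for i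
    using int4 m1 m2 by (simp_all add: transfer[of "\<lambda>y. (y - \<mu>) ^ 4"]
      transfer[of "\<lambda>y. y - \<mu>"] transfer[of "\<lambda>y. (y - \<mu>)\<^sup>2"] m_def)
  from P.sample_variance_moments[OF comp(1) this n]
  have Z: "integrable ?P Z" "integrable ?P (\<lambda>Y. (Z Y)\<^sup>2)" "P.expectation Z = 0"
    "P.expectation (\<lambda>Y. (Z Y)\<^sup>2) = (m - (real n - 3) / (real n - 1) * v\<^sup>2) / real n"
    unfolding Z_def by simp_all

  define q where "q = 1 - 1 / C\<^sup>2"
  define R where "R = sqrt (\<alpha> * (1 - \<beta>) / ((1 - \<alpha>) * \<beta>))"
  define w where "w = v\<^sup>2 * (\<alpha> / (1 - \<alpha>)) * q\<^sup>2"
  define t where "t = v * q * R"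
  have C2: "1 < C\<^sup>2" using C by (simp add: one_less_power)
  then have q: "0 < q" using C by (simp add: q_def divide_less_eq_1)
  have R: "0 < R" "R\<^sup>2 = \<alpha> / (1 - \<alpha>) * ((1 - \<beta>) / \<beta>)"
    using \<alpha> \<beta> by (simp_all add: R_def)
  have w: "0 < w" using v q \<alpha> by (simp add: w_def)
  have t: "0 < t" using v q R by (simp add: t_def)
  have "m - (real n - 3) / (real n - 1) * v\<^sup>2 \<le> real n * w"
    using m_le by (simp add: kappa_max_def w_def q_def algebra_simps)
  then have Zw: "P.expectation (\<lambda>Y. (Z Y)\<^sup>2) \<le> w"
    using n by (simp add: Z divide_le_eq mult.commute)
  have "t\<^sup>2 = w * ((1 - \<beta>) / \<beta>)"
    by (simp add: t_def w_def power_mult_distrib R)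
  then have "w + t\<^sup>2 = w / \<beta>" using \<beta> by (simp add: field_simps)
  then have "\<P>(Y in ?P. t \<le> Z Y) \<le> \<beta>"
    using P.Cantelli_inequality[OF Z(1-3) Zw t] w \<beta> by simp
  moreover have [measurable]: "Z \<in> borel_measurable ?P" using Z(1) by simp
  then have "{Y \<in> space ?P. t \<le> Z Y} \<in> P.events" by measurable
  then have "\<P>(Y in ?P. \<not> t \<le> Z Y) = 1 - \<P>(Y in ?P. t \<le> Z Y)" by (rule P.prob_neg)
  ultimately have "1 - \<beta> \<le> \<P>(Y in ?P. \<not> t \<le> Z Y)" by simp
  also have "\<dots> \<le> \<P>(Y in ?P. sigma_hat n C Y \<le> \<sigma>_max * v_factor \<alpha> \<beta> C)"
  proof (rule P.finite_measure_mono)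
    show "{Y \<in> space ?P. \<not> t \<le> Z Y} \<subseteq>
        {Y \<in> space ?P. sigma_hat n C Y \<le> \<sigma>_max * v_factor \<alpha> \<beta> C}"
    proof safe
      fix Y assume "\<not> t \<le> Z Y"
      then have "C\<^sup>2 * sample_variance n Y \<le> C\<^sup>2 * (v + t)"
        using C by (simp add: Z_def)
      also have "\<dots> = v * (C\<^sup>2 + (C\<^sup>2 - 1) * R)"
        using C by (simp add: t_def q_def field_simps)
      finally have "sigma_hat n C Y \<le> sqrt (v * (C\<^sup>2 + (C\<^sup>2 - 1) * R))"
        by (simp add: sigma_hat_def)
      also have "\<dots> = df_sd F * v_factor \<alpha> \<beta> C"
        using F'(3) by (simp add: real_sqrt_mult v_def v_factor_def R_def)
      also have "\<dots> \<le> \<sigma>_max * v_factor \<alpha> \<beta> C"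
      proof (rule mult_right_mono[OF F'(4)])
        have "0 \<le> C\<^sup>2 + (C\<^sup>2 - 1) * R" using C2 R by (intro add_nonneg_nonneg) auto
        then show "0 \<le> v_factor \<alpha> \<beta> C" by (simp add: v_factor_def R_def)
      qed
      finally show "sigma_hat n C Y \<le> \<sigma>_max * v_factor \<alpha> \<beta> C" .
    qed
    have [measurable]: "sigma_hat n C \<in> borel_measurable ?P"
      by (rule sigma_hat_measurable) (rule rv)
    show "{Y \<in> space ?P. sigma_hat n C Y \<le> \<sigma>_max * v_factor \<alpha> \<beta> C} \<in> P.events"
      by measurable
  qed
  finally show ?thesis by (simp add: P)
qed

lemma alpha_tilde_bounds:
  assumes "0 < \<alpha>" "\<alpha> < 1"
  shows "0 < alpha_tilde \<alpha>" "alpha_tilde \<alpha> < 1"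
  using assms by (auto simp: alpha_tilde_def)

text \<open>
  Since \<open>N_mu\<close> is monotone, the bound on \<open>sigma_hat\<close> passes to the number of samples.
  Monotonicity also makes the event about \<open>N_tot\<close> measurable. This matters because the measure of a
  nonmeasurable set is 0 by convention, which would spoil the lower bound on its probability.
\<close>

theorem theorem6:
  fixes n\<^sub>\<sigma> :: nat and C \<alpha> \<beta> \<epsilon> \<sigma>_max \<kappa>_max :: real
  assumes "2 \<le> n\<^sub>\<sigma>"
    and "1 < C"
    and "0 < \<alpha>" and "\<alpha> < 1"
    and "0 < \<beta>" and "\<beta> < 1"
    and "0 < \<epsilon>"
    and "0 < \<sigma>_max"
    and "\<kappa>_max = kappa_max (alpha_tilde \<alpha>) n\<^sub>\<sigma> C"
  shows "prob_cost n\<^sub>\<sigma> C \<epsilon> \<alpha> \<beta> \<kappa>_max \<sigma>_max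
           \<le> enat (N_up n\<^sub>\<sigma> C \<epsilon> \<alpha> \<beta> \<kappa>_max \<sigma>_max)"
  unfolding prob_cost_def
proof (rule SUP_least)
  fix F assume F: "F \<in> admissible \<kappa>_max \<sigma>_max"
  note \<alpha>t = alpha_tilde_bounds[OF assms(3,4)]
  let ?M = "\<kappa>_max powr (3/4)"
  let ?s = "\<sigma>_max * v_factor (alpha_tilde \<alpha>) \<beta> C"
  let ?U = "N_up n\<^sub>\<sigma> C \<epsilon> \<alpha> \<beta> \<kappa>_max \<sigma>_max"
  have "real_distribution (interval_measure F)"
    using F by (intro distribution_function_real_distribution) (simp add: admissible_def)
  then interpret N: real_distribution "interval_measure F" .
  interpret P: prob_space "iid_space F"
    unfolding iid_space_def by (intro prob_space_PiM N.prob_space_axioms)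
  have "(\<lambda>x. x i) \<in> borel_measurable (iid_space F)" for i
    unfolding iid_space_def by (simp cong: measurable_cong_sets)
  then have [measurable]: "sigma_hat n\<^sub>\<sigma> C \<in> borel_measurable (iid_space F)"
    by (rule sigma_hat_measurable)
  have nonneg: "0 \<le> sigma_hat n\<^sub>\<sigma> C Y" for Y
    using assms(1) by (simp add: sigma_hat_def sample_variance_nonneg)
  \<comment> \<open>Truncation at 0 extends the monotonicity of \<open>N_mu\<close> from nonnegative arguments to all reals.\<close>
  define g where "g s = real (N_mu \<epsilon> (max 0 s) (alpha_tilde \<alpha>) ?M)" for s
  have "mono g"
    unfolding g_def using assms(7) \<alpha>t(1) by (intro monoI) (auto intro!: N_mu_mono)
  then have [measurable]: "g \<in> borel_measurable borel" by (rule borel_measurable_mono)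
  have tot: "N_tot n\<^sub>\<sigma> C \<epsilon> \<alpha> \<kappa>_max Y \<le> ?U \<longleftrightarrow>
      g (sigma_hat n\<^sub>\<sigma> C Y) \<le> real (N_mu \<epsilon> ?s (alpha_tilde \<alpha>) ?M)" for Y
    using nonneg[of Y] by (simp add: N_tot_def N_up_def g_def max_def)
  have "1 - \<beta> \<le> \<P>(Y in iid_space F. sigma_hat n\<^sub>\<sigma> C Y \<le> ?s)"
    using F assms \<alpha>t by (intro sigma_hat_quantile_bound) auto
  also have "\<dots> \<le> \<P>(Y in iid_space F. N_tot n\<^sub>\<sigma> C \<epsilon> \<alpha> \<kappa>_max Y \<le> ?U)"
  proof (rule P.finite_measure_mono)
    show "{Y \<in> space (iid_space F). sigma_hat n\<^sub>\<sigma> C Y \<le> ?s} \<subseteq>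
        {Y \<in> space (iid_space F). N_tot n\<^sub>\<sigma> C \<epsilon> \<alpha> \<kappa>_max Y \<le> ?U}"
      using nonneg assms(7) \<alpha>t(1) by (auto simp: N_tot_def N_up_def intro!: N_mu_mono)
    show "{Y \<in> space (iid_space F). N_tot n\<^sub>\<sigma> C \<epsilon> \<alpha> \<kappa>_max Y \<le> ?U} \<in> P.events"
      unfolding tot by measurable
  qed
  finally have "1 - \<beta> \<le> \<P>(Y in iid_space F. N_tot n\<^sub>\<sigma> C \<epsilon> \<alpha> \<kappa>_max Y \<le> ?U)" .
  moreover have "1 \<le> ?U" using assms(1) by (simp add: N_up_def)
  ultimately show "enat (LEAST N. 1 \<le> N \<and>
      \<P>(Y in iid_space F. N_tot n\<^sub>\<sigma> C \<epsilon> \<alpha> \<kappa>_max Y \<le> N) \<ge> 1 - \<beta>) \<le> enat ?U"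
    by (simp add: Least_le)
qed

end
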